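(* Let $\mathcal{H}$ be a separable Hilbert space, let $K\in\mathcal{L}(\mathcal{H})$, let $\{\mathcal{W}_i\}_{i\in I}$ be a family of closed subspaces of $\mathcal{H}$ and let $\{v_i\}_{i\in I}$ be a family of positive weights. Then the following statements are equivalent: (1) $\{(\mathcal{W}_i,v_i)\}_{i\in I}$ is an atomic subspace of $\mathcal{H}$ with respect to $K$. (2) There exist constants $A,B>0$ such that for all $f\in\mathcal{H}$, $$A\|K^*f\|^2\le\sum_{i\in I}v_i^2\|P_{\mathcal{W}_i}f\|^2\le B\|f\|^2.$$
   Context: The index set $I$ is finite or countable. $\mathcal{L}(\mathcal{H})$ is the space of bounded linear operators on $\mathcal{H}$, and $P_{\mathcal{W}}$ denotes the orthogonal projection of $\mathcal{H}$ onto the closed subspace $\mathcal{W}$. Put $\left(\sum_{i\in I}\oplus\mathcal{W}_i\right)_{l^2}=\{\{f_i\}_{i\in I}: f_i\in\mathcal{W}_i,\ \sum_{i\in I}\|f_i\|^2<\infty\}$, with inner product $\langle\{f_i\},\{g_i\}\rangle=\sum_{i\in I}\langle f_i,g_i\rangle_{\mathcal{H}}$. Definition (atomic subspace). $\{(\mathcal{W}_i,v_i)\}_{i\in I}$ is an atomic subspace of $\mathcal{H}$ with respect to $K\in\mathcal{L}(\mathcal{H})$ if: (a) $\sum_{i\in I}v_if_i$ converges in $\mathcal{H}$ for all $\{f_i\}_{i\in I}\in\left(\sum_{i\in I}\oplus\mathcal{W}_i\right)_{l^2}$; and (b) there is a constant $C>0$ such that for every $f\in\mathcal{H}$ there exists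 $\{f_i\}_{i\in I}\in\left(\sum_{i\in I}\oplus\mathcal{W}_i\right)_{l^2}$ with $Kf=\sum_{i\in I}v_if_i$ and $\|\{f_i\}\|_{(\sum_{i\in I}\oplus\mathcal{W}_i)_{l^2}}\le C\|f\|_{\mathcal{H}}$. *)

theory Defs
  imports "HOL-Analysis.Analysis"
begin

(* Scalars.  "Hilbert space" means a real or a complex one.  The axioms of this class determine
   the pair (field, conjugation) up to isomorphism: it is \<real> with the identity or \<complex> with complex
   conjugation, since each x is a root of X^2 - 2 (re x) X + (norm x)^2.
   Inside the class, r *\<^sub>R 1 stands for of_real r. *)
class rc_field = real_normed_field +
  fixes rc_conj :: "'a \<Rightarrow> 'a"
    and rc_re :: "'a \<Rightarrow> real"
  assumes rc_conj_add: "rc_conj (x + y) = rc_conj x + rc_conj y"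
    and rc_conj_mult: "rc_conj (x * y) = rc_conj x * rc_conj y"
    and rc_conj_of_real: "rc_conj (r *\<^sub>R 1) = r *\<^sub>R 1"
    and rc_add_conj: "x + rc_conj x = (2 * rc_re x) *\<^sub>R 1"
    and rc_mult_conj: "x * rc_conj x = (norm x)\<^sup>2 *\<^sub>R 1"

instantiation real :: rc_field
begin
definition rc_conj_real :: "real \<Rightarrow> real" where "rc_conj_real x = x"
definition rc_re_real :: "real \<Rightarrow> real" where "rc_re_real x = x"
instance
  by standard (simp_all add: rc_conj_real_def rc_re_real_def power2_eq_square)
end

instantiation complex :: rc_field
begin
definition rc_conj_complex :: "complex \<Rightarrow> complex" where "rc_conj_complex = cnj"
definition rc_re_complex :: "complex \<Rightarrow> real" where "rc_re_complex = Re"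
instance
  by standard (simp_all add: rc_conj_complex_def rc_re_complex_def complex_add_cnj
      scaleR_conv_of_real flip: complex_norm_square)
end

(* The Hilbert space is a whole type 'a; its norm, which is complete by the class banach, is the one
   induced by ip, and its scalar multiplication extends the multiplication by reals of 'a.
   ip is linear in the first argument. *)
locale hilbert_space = vector_space smul
  for smul :: "'k::rc_field \<Rightarrow> 'a::banach \<Rightarrow> 'a" +
  fixes ip :: "'a \<Rightarrow> 'a \<Rightarrow> 'k"
  assumes smul_of_real: "smul (of_real r) x = r *\<^sub>R x"
    and ip_add_left: "ip (x + y) z = ip x z + ip y z"
    and ip_smul_left: "ip (smul c x) y = c * ip x y"
    and ip_commute: "ip x y = rc_conj (ip y x)"
    and ip_self: "ip x x = of_real ((norm x)\<^sup>2)"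

lemma hilbert_space_real:
  "hilbert_space scaleR (inner :: 'a::{real_inner, banach} \<Rightarrow> 'a \<Rightarrow> real)"
  by unfold_locales
    (auto simp: rc_conj_real_def inner_add_left inner_commute power2_norm_eq_inner algebra_simps)

lemma hilbert_space_complex: "hilbert_space (*) (\<lambda>x y :: complex. x * cnj y)"
  by unfold_locales
    (auto simp: rc_conj_complex_def algebra_simps scaleR_conv_of_real
      simp flip: complex_norm_square)

definition bounded_operator :: "('k::rc_field \<Rightarrow> 'a::banach \<Rightarrow> 'a) \<Rightarrow> ('a \<Rightarrow> 'a) \<Rightarrow> bool"
  where "bounded_operator smul K \<longleftrightarrow>
    Vector_Spaces.linear smul smul K \<and> (\<exists>M. \<forall>x. norm (K x) \<le> M * norm x)"

definition hilbert_adjoint :: "('a \<Rightarrow> 'a \<Rightarrow> 'k) \<Rightarrow> ('a \<Rightarrow> 'a) \<Rightarrow> 'a \<Rightarrow> 'a"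
  where "hilbert_adjoint ip K = (THE L. \<forall>x y. ip (K x) y = ip x (L y))"

definition orth_proj :: "('a::minus \<Rightarrow> 'a \<Rightarrow> 'k::zero) \<Rightarrow> 'a set \<Rightarrow> 'a \<Rightarrow> 'a"
  where "orth_proj ip W f = (THE y. y \<in> W \<and> (\<forall>w\<in>W. ip (f - y) w = 0))"

(* Families indexed by I are functions on the whole index type; only their values on I matter. *)
definition l2_sum :: "'i set \<Rightarrow> ('i \<Rightarrow> 'a::banach set) \<Rightarrow> ('i \<Rightarrow> 'a) set"
  where "l2_sum I W = {f. (\<forall>i\<in>I. f i \<in> W i) \<and> (\<lambda>i. (norm (f i))\<^sup>2) summable_on I}"

definition l2_ip :: "('a \<Rightarrow> 'a \<Rightarrow> 'k::rc_field) \<Rightarrow> 'i set \<Rightarrow> ('i \<Rightarrow> 'a) \<Rightarrow> ('i \<Rightarrow> 'a) \<Rightarrow> 'k"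
  where "l2_ip ip I f g = (\<Sum>\<^sub>\<infinity>i\<in>I. ip (f i) (g i))"

definition l2_norm :: "('a \<Rightarrow> 'a \<Rightarrow> 'k::rc_field) \<Rightarrow> 'i set \<Rightarrow> ('i \<Rightarrow> 'a) \<Rightarrow> real"
  where "l2_norm ip I f = sqrt (rc_re (l2_ip ip I f f))"

(* I carries no order, so convergence of a series over I is unconditional convergence. *)
definition atomic_subspace ::
    "('a::banach \<Rightarrow> 'a \<Rightarrow> 'k::rc_field) \<Rightarrow> 'i set \<Rightarrow> ('i \<Rightarrow> 'a set) \<Rightarrow> ('i \<Rightarrow> real)
      \<Rightarrow> ('a \<Rightarrow> 'a) \<Rightarrow> bool"
  where "atomic_subspace ip I W v K \<longleftrightarrow>
    (\<forall>f\<in>l2_sum I W. (\<lambda>i. v i *\<^sub>R f i) summable_on I) \<and>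
    (\<exists>C>0. \<forall>x. \<exists>f\<in>l2_sum I W.
        ((\<lambda>i. v i *\<^sub>R f i) has_sum K x) I \<and> l2_norm ip I f \<le> C * norm x)"

end

theory Submission
  imports Defs
begin

text \<open>Put \<open>T f = (\<Sum>i. v\<^sub>i f\<^sub>i)\<close> on the \<open>l\<^sup>2\<close> sum of the subspaces. Its adjoint is \<open>x \<mapsto> (v\<^sub>i P\<^sub>i x)\<^sub>i\<close>, so the
  upper inequality says that \<open>T\<close> is bounded, and the lower one that \<open>A K K\<^sup>* \<le> T T\<^sup>*\<close>. If the family is
  atomic, \<open>T\<close> is bounded by a uniform boundedness argument, and representing \<open>K K\<^sup>* x\<close> as \<open>T f\<close>
  bounds \<open>\<parallel>K\<^sup>* x\<parallel>\<^sup>2 = \<langle>T f, x\<rangle>\<close> by \<open>C \<parallel>K\<^sup>* x\<parallel> \<parallel>T\<^sup>* x\<parallel>\<close>. Conversely the lower inequality yields \<open>f\<close>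
  with \<open>K x = T f\<close> by Riesz representation on the closure of the range of \<open>T\<^sup>*\<close> (Douglas).
  All of this uses only the real part of the inner product.\<close>

section \<open>Series and forms\<close>

text \<open>The Cauchy criterion for the net of finite partial sums, with completeness for the
  converse. It serves both to prove synthesis series convergent and to contradict their
  convergence.\<close>

lemma summable_on_iff_small_tails:
  fixes f :: "'i \<Rightarrow> 'b::banach"
  shows "f summable_on A \<longleftrightarrow>
    (\<forall>e>0. \<exists>X. finite X \<and> X \<subseteq> A \<and> (\<forall>Y. finite Y \<and> Y \<subseteq> A - X \<longrightarrow> norm (sum f Y) < e))"
    (is "_ \<longleftrightarrow> ?tails")
proof
  assume "f summable_on A"
  then obtain s where s: "(sum f \<longlongrightarrow> s) (finite_subsets_at_top A)"
    by (auto simp: summable_on_def has_sum_def)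
  show ?tails
  proof (intro allI impI)
    fix e :: real assume "e > 0"
    then have "\<forall>\<^sub>F F in finite_subsets_at_top A. dist (sum f F) s < e / 2"
      using tendstoD[OF s, of "e / 2"] by simp
    then obtain X where X: "finite X" "X \<subseteq> A"
      and *: "\<And>Y. finite Y \<Longrightarrow> X \<subseteq> Y \<Longrightarrow> Y \<subseteq> A \<Longrightarrow> dist (sum f Y) s < e / 2"
      by (auto simp: eventually_finite_subsets_at_top)
    have "norm (sum f Y) < e" if "finite Y" "Y \<subseteq> A - X" for Y
    proof -
      have "sum f (X \<union> Y) = sum f X + sum f Y"
        using that X by (intro sum.union_disjoint) auto
      moreover have "dist (sum f (X \<union> Y)) (sum f X) < e"
        by (rule dist_triangle_half_l[of _ s]; rule *) (use X that in auto)
      ultimately show ?thesis by (simp add: dist_norm)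
    qed
    then show "\<exists>X. finite X \<and> X \<subseteq> A \<and> (\<forall>Y. finite Y \<and> Y \<subseteq> A - X \<longrightarrow> norm (sum f Y) < e)"
      using X by blast
  qed
next
  assume tails: ?tails
  have "cauchy_filter (filtermap (sum f) (finite_subsets_at_top A))"
    unfolding cauchy_filter_metric_filtermap
  proof (intro allI impI)
    fix e :: real assume "e > 0"
    then obtain X where X: "finite X" "X \<subseteq> A"
      and *: "\<And>Y. finite Y \<Longrightarrow> Y \<subseteq> A - X \<Longrightarrow> norm (sum f Y) < e / 2"
      using tails[rule_format, of "e / 2"] by auto
    have near: "dist (sum f F) (sum f X) < e / 2" if "finite F" "X \<subseteq> F" "F \<subseteq> A" for F
    proof -
      have "sum f F = sum f X + sum f (F - X)"
        using that by (subst sum.subset_diff[of X F]) (auto simp: add.commute)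
      then show ?thesis using *[of "F - X"] that by (auto simp: dist_norm)
    qed
    show "\<exists>P. eventually P (finite_subsets_at_top A) \<and>
        (\<forall>F G. P F \<and> P G \<longrightarrow> dist (sum f F) (sum f G) < e)"
    proof (intro exI conjI allI impI)
      show "\<forall>\<^sub>F F in finite_subsets_at_top A. finite F \<and> X \<subseteq> F \<and> F \<subseteq> A"
        using X by (auto simp: eventually_finite_subsets_at_top)
      fix F G assume "(finite F \<and> X \<subseteq> F \<and> F \<subseteq> A) \<and> (finite G \<and> X \<subseteq> G \<and> G \<subseteq> A)"
      then show "dist (sum f F) (sum f G) < e"
        using dist_triangle_half_l[of "sum f F" "sum f X" e "sum f G"] near[of F] near[of G] by simp
    qed
  qed
  then obtain s where "filtermap (sum f) (finite_subsets_at_top A) \<le> nhds s"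
    using cauchy_filter_complete_converges[of "filtermap (sum f) (finite_subsets_at_top A)" UNIV]
      complete_UNIV
    by (auto simp: filtermap_bot_iff)
  then show "f summable_on A"
    by (auto simp: summable_on_def has_sum_def filterlim_def)
qed

text \<open>Definiteness is left out on purpose: besides the real inner product the frame form is an
  instance, and it may vanish on nonzero vectors.\<close>

locale pre_inner =
  fixes q :: "'v::real_vector \<Rightarrow> 'v \<Rightarrow> real"
  assumes commute: "q x y = q y x"
    and add_left: "q (x + y) z = q x z + q y z"
    and scale_left: "q (r *\<^sub>R x) z = r * q x z"
    and nonneg: "0 \<le> q x x"
begin

lemma add_right: "q z (x + y) = q z x + q z y"
  by (metis add_left commute)

lemma scale_right: "q z (r *\<^sub>R x) = r * q z x"
  by (metis scale_left commute)

lemma diff_left: "q (x - y) z = q x z - q y z"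
  by (metis add_left add_diff_cancel_right' diff_add_cancel)

lemma diff_right: "q z (x - y) = q z x - q z y"
  by (metis diff_left commute)

lemma zero_left: "q 0 z = 0"
  using diff_left[of 0 0 z] by simp

lemma cauchy_schwarz: "(q x y)\<^sup>2 \<le> q x x * q y y"
proof -
  have key: "0 \<le> q x x + 2 * t * q x y + t\<^sup>2 * q y y" for t
  proof -
    have "q (x + t *\<^sub>R y) (x + t *\<^sub>R y) = q x x + 2 * t * q x y + t\<^sup>2 * q y y"
      using commute[of y x]
      by (simp add: add_left add_right scale_left scale_right power2_eq_square algebra_simps)
    then show ?thesis using nonneg by metis
  qed
  show ?thesis
  proof (cases "q y y = 0")
    case True
    \<comment> \<open>Here the polynomial is affine in t; a nonzero slope would let it take the
      value -1.\<close>
    have "q x y = 0"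
    proof (rule ccontr)
      assume "q x y \<noteq> 0"
      moreover define t where "t = - (q x x + 1) / (2 * q x y)"
      ultimately have "2 * t * q x y = - (q x x + 1)" by simp
      then show False using key[of t] True by simp
    qed
    then show ?thesis using True by simp
  next
    case False
    then have "q y y > 0" using nonneg[of y] by simp
    \<comment> \<open>The minimiser of the quadratic polynomial in \<open>key\<close>.\<close>
    define t where "t = - q x y / q y y"
    have t: "t * q y y = - q x y" using False by (simp add: t_def)
    have "0 \<le> q y y * (q x x + 2 * t * q x y + t\<^sup>2 * q y y)"
      using key \<open>q y y > 0\<close> by simp
    also have "\<dots> = q x x * q y y + 2 * (t * q y y) * q x y + (t * q y y)\<^sup>2"
      by (simp add: power2_eq_square algebra_simps)
    finally show ?thesis by (simp add: t power2_eq_square)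
  qed
qed

lemmas expand = add_left add_right scale_left scale_right diff_left diff_right

text \<open>Riesz representation without completeness: a minimising sequence \<open>y\<close> of
  \<open>q y y - 2 * l y\<close> is Cauchy by the parallelogram law and represents \<open>l\<close> in the limit.\<close>

lemma riesz_sequence:
  assumes V: "subspace V" and l: "linear l" and C: "C \<ge> 0"
    and bound: "\<And>x. x \<in> V \<Longrightarrow> l x \<le> C * sqrt (q x x)"
  obtains y :: "nat \<Rightarrow> 'v" where "\<And>n. y n \<in> V" "\<And>n. q (y n) (y n) \<le> (2 * C)\<^sup>2"
    "\<And>n m. n \<le> m \<Longrightarrow> q (y n - y m) (y n - y m) \<le> 4 / (real n + 1)"
    "\<And>z. z \<in> V \<Longrightarrow> (\<lambda>n. q (y n) z) \<longlonglongrightarrow> l z"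
proof -
  interpret l: linear l by fact
  \<comment> \<open>If y0 represents \<open>l\<close>, then \<open>J y\<close> is the squared
    \<open>q\<close>-distance from y to y0 minus the constant \<open>q y0 y0\<close>, so minimising
    J approximates y0.\<close>
  define J where "J y = q y y - 2 * l y" for y
  have J_ge: "J y \<ge> - C\<^sup>2" if "y \<in> V" for y
  proof -
    have "0 \<le> (sqrt (q y y) - C)\<^sup>2" by simp
    also have "\<dots> = q y y - 2 * (C * sqrt (q y y)) + C\<^sup>2"
      using nonneg[of y] by (simp add: power2_diff)
    also have "\<dots> \<le> J y + C\<^sup>2"
      using bound[OF that] by (simp add: J_def)
    finally show ?thesis by simp
  qed
  define m where "m = Inf (J ` V)"
  have m_le: "m \<le> J y" if "y \<in> V" for y
    unfolding m_def using J_ge that by (intro cInf_lower bdd_belowI2[where m="- C\<^sup>2"]) auto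
  have V0: "0 \<in> V" using V by (rule subspace_0)
  have "\<exists>y\<in>V. J y \<le> 0 \<and> J y < m + 1 / (real n + 1)" for n
  proof -
    have "Inf (J ` V) < m + 1 / (real n + 1)" unfolding m_def by simp
    moreover have "J ` V \<noteq> {}" using V0 by blast
    ultimately obtain y where "y \<in> V" "J y < m + 1 / (real n + 1)"
      using cInf_lessD[of "J ` V" "m + 1 / (real n + 1)"] by (auto simp: m_def)
    moreover have "J 0 = 0" by (simp add: J_def zero_left l.zero)
    ultimately show ?thesis
    proof (cases "J y \<le> 0")
      \<comment> \<open>A near-minimiser with J positive is replaced by 0; the sign of J later
        bounds \<open>q (y n) (y n)\<close>.\<close>
      case False
      with \<open>J y < _\<close> \<open>J 0 = 0\<close> show ?thesis by (intro bexI[OF _ V0]) simp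
    qed blast
  qed
  then have "\<exists>y. \<forall>n. y n \<in> V \<and> J (y n) \<le> 0 \<and> J (y n) < m + 1 / (real n + 1)"
    by (intro choice) blast
  then obtain y where yV: "\<And>n. y n \<in> V" and J0: "\<And>n. J (y n) \<le> 0"
    and Jm: "\<And>n. J (y n) < m + 1 / (real n + 1)"
    by blast
  have "q (y n) (y n) \<le> (2 * C)\<^sup>2" for n
  proof -
    define s where "s = sqrt (q (y n) (y n))"
    have s: "s \<ge> 0" "s\<^sup>2 = q (y n) (y n)" by (simp_all add: s_def nonneg)
    have "s * s \<le> (2 * C) * s"
      using J0[of n] bound[OF yV[of n]] s by (simp add: J_def s_def[symmetric] power2_eq_square)
    then have "s \<le> 2 * C"
      using C s(1) by (cases "s = 0") (auto simp: mult_le_cancel_right)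
    then show ?thesis
      using power_mono[of s "2 * C" 2] s by simp
  qed
  moreover have "q (y n - y k) (y n - y k) \<le> 4 / (real n + 1)" if "n \<le> k" for n k
  proof -
    \<comment> \<open>Parallelogram law: J at the midpoint is at least m, so only the excesses
      1/(n+1) and 1/(k+1) of the endpoints remain.\<close>
    let ?h = "(1/2) *\<^sub>R (y n + y k)"
    have "?h \<in> V" using yV V by (intro subspace_scale subspace_add)
    then have "m \<le> J ?h" by (rule m_le)
    moreover have "q (y n - y k) (y n - y k) = 2 * J (y n) + 2 * J (y k) - 4 * J ?h"
      using commute[of "y k" "y n"] by (simp add: J_def expand l.add l.scale algebra_simps)
    moreover have "1 / (real k + 1) \<le> 1 / (real n + 1)"
      using that by (simp add: field_simps)
    ultimately show ?thesis using Jm[of n] Jm[of k] by simp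
  qed
  moreover have "(\<lambda>n. q (y n) z) \<longlonglongrightarrow> l z" if z: "z \<in> V" for z
  proof -
    define Q where "Q = q z z"
    have Q: "Q \<ge> 0" by (simp add: Q_def nonneg)
    have dist_le: "\<bar>q (y n) z - l z\<bar> \<le> sqrt (1 / (real n + 1) * (Q + 1))" for n
    proof -
      define d where "d = q (y n) z - l z"
      \<comment> \<open>Modelled on the minimiser -d/Q of the perturbation; Q + 1 avoids division by
        zero when \<open>q z z\<close> vanishes.\<close>
      define t where "t = - d / (Q + 1)"
      let ?e = "1 / (real n + 1)"
      have "y n + t *\<^sub>R z \<in> V" using yV V z by (intro subspace_scale subspace_add)
      then have "m \<le> J (y n + t *\<^sub>R z)" by (rule m_le)
      also have "\<dots> = J (y n) + 2 * t * d + t\<^sup>2 * Q"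
        using commute[of z "y n"]
        by (simp add: J_def expand l.add l.scale d_def Q_def power2_eq_square algebra_simps)
      finally have "0 \<le> 2 * t * d + t\<^sup>2 * Q + ?e" using Jm[of n] by simp
      moreover have "t\<^sup>2 * Q \<le> t\<^sup>2 * (Q + 1)" by (simp add: algebra_simps)
      moreover have "t\<^sup>2 * (Q + 1) = - t * d"
        using Q by (simp add: t_def power2_eq_square)
      ultimately have "- t * d \<le> ?e" by simp
      then have "d\<^sup>2 / (Q + 1) \<le> ?e" by (simp add: t_def power2_eq_square)
      then have "d\<^sup>2 \<le> ?e * (Q + 1)"
        using Q by (subst (asm) pos_divide_le_eq) auto
      then show ?thesis
        unfolding d_def[symmetric] real_sqrt_abs[symmetric] by (rule real_sqrt_le_mono)
    qed
    have "(\<lambda>n. sqrt (1 / (real n + 1) * (Q + 1))) \<longlonglongrightarrow> sqrt (0 * (Q + 1))"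
      using LIMSEQ_inverse_real_of_nat
      by (intro tendsto_real_sqrt tendsto_mult tendsto_const) (simp add: inverse_eq_divide add.commute)
    then have "(\<lambda>n. q (y n) z - l z) \<longlonglongrightarrow> 0"
      unfolding mult_zero_left real_sqrt_zero
      by (rule Lim_null_comparison[OF always_eventually, rotated])
        (simp only: real_norm_def dist_le simp_thms)
    then show ?thesis by (rule LIM_zero_cancel)
  qed
  ultimately show thesis by (rule that[OF yV])
qed

end

section \<open>The real inner product, projections and adjoints\<close>

lemma of_real_rc_re: "(of_real (2 * rc_re x) :: 'k::rc_field) = x + rc_conj x"
  by (metis of_real_def rc_add_conj)

text \<open>\<open>rc_re\<close> is specified only through the sum of a scalar and its conjugate, so
  real parts are computed by comparing such sums.\<close>

lemma rc_re_eqI: "x + rc_conj x = (of_real (2 * r) :: 'k::rc_field) \<Longrightarrow> rc_re x = r"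
  unfolding of_real_rc_re[symmetric] of_real_eq_iff by simp

lemma rc_conj_of_real': "rc_conj (of_real r) = (of_real r :: 'k::rc_field)"
  by (simp add: of_real_def rc_conj_of_real)

lemma rc_re_of_real: "rc_re (of_real r :: 'k::rc_field) = r"
  by (rule rc_re_eqI) (simp add: rc_conj_of_real')

lemma rc_re_add: "rc_re (x + y :: 'k::rc_field) = rc_re x + rc_re y"
proof (rule rc_re_eqI)
  have "x + y + rc_conj (x + y) = (x + rc_conj x) + (y + rc_conj y)"
    by (simp add: rc_conj_add)
  then show "x + y + rc_conj (x + y) = of_real (2 * (rc_re x + rc_re y))"
    by (simp only: of_real_rc_re[symmetric] of_real_add[symmetric] distrib_left)
qed

lemma rc_re_of_real_mult: "rc_re (of_real r * x :: 'k::rc_field) = r * rc_re x"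
proof (rule rc_re_eqI)
  have "of_real r * x + rc_conj (of_real r * x) = of_real r * (x + rc_conj x)"
    by (simp add: rc_conj_mult rc_conj_of_real' distrib_left)
  then show "of_real r * x + rc_conj (of_real r * x) = of_real (2 * (r * rc_re x))"
    by (simp only: of_real_rc_re[symmetric] of_real_mult[symmetric] mult.left_commute)
qed

text \<open>Testing with c equal to the conjugate of d gives the squared norm of d. This lifts
  identities between real parts to scalar-valued ones.\<close>

lemma eq_0_if_rc_re_mult_eq_0:
  assumes "\<And>c. rc_re (c * d) = 0"
  shows "d = (0 :: 'k::rc_field)"
proof -
  have "rc_conj d * d = of_real ((norm d)\<^sup>2)"
    by (metis mult.commute of_real_def rc_mult_conj)
  then show ?thesis
    using assms[of "rc_conj d"] by (simp only: rc_re_of_real) simp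
qed

lemma Cauchy_if_norm_diff_sq_le:
  fixes y :: "nat \<Rightarrow> 'a::real_normed_vector"
  assumes "\<And>n m. n \<le> m \<Longrightarrow> (norm (y n - y m))\<^sup>2 \<le> c / (real n + 1)"
  shows "Cauchy y"
proof (rule CauchyI')
  fix e :: real assume e: "e > 0"
  obtain N :: nat where N: "c / e\<^sup>2 < real N" using reals_Archimedean2 by blast
  have "norm (y n - y m) < e" if "N \<le> n" "n < m" for n m
  proof (rule power2_less_imp_less)
    have "c / e\<^sup>2 < real n + 1" using N that by linarith
    then have "c / (real n + 1) < e\<^sup>2" using e by (simp add: field_simps)
    then show "(norm (y n - y m))\<^sup>2 < e\<^sup>2" using assms[of n m] that by simp
  qed (use e in simp)
  then show "\<exists>M. \<forall>m\<ge>M. \<forall>n>m. dist (y m) (y n) < e"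
    by (intro exI[of _ N]) (simp add: dist_norm)
qed

context hilbert_space
begin

text \<open>A real inner product inducing the given norm, over either scalar field; it reduces the
  analysis to the real case.\<close>

definition re_ip :: "'a \<Rightarrow> 'a \<Rightarrow> real"
  where "re_ip x y = rc_re (ip x y)"

lemma ip_scaleR_left: "ip (r *\<^sub>R x) y = of_real r * ip x y"
  by (simp flip: smul_of_real add: ip_smul_left)

lemma ip_diff_left: "ip (x - y) z = ip x z - ip y z"
  by (metis ip_add_left add_diff_cancel_right' diff_add_cancel)

lemma ip_add_right: "ip z (x + y) = ip z x + ip z y"
  using ip_commute[of z "x + y"] ip_commute[of z x] ip_commute[of z y]
  by (simp add: ip_add_left rc_conj_add)

lemma ip_diff_right: "ip z (x - y) = ip z x - ip z y"
  by (metis ip_add_right add_diff_cancel_right' diff_add_cancel)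

lemma ip_eq_0_commute: "ip x y = 0 \<Longrightarrow> ip y x = 0"
  using rc_conj_of_real'[of 0, where 'k='k] ip_commute[of y x] by simp

lemma re_ip_self: "re_ip x x = (norm x)\<^sup>2"
  unfolding re_ip_def ip_self by (rule rc_re_of_real)

sublocale re: pre_inner re_ip
proof
  fix x y z :: 'a and r :: real
  show "re_ip x y = re_ip y x"
    unfolding re_ip_def
  proof (rule rc_re_eqI)
    show "ip x y + rc_conj (ip x y) = of_real (2 * rc_re (ip y x))"
      unfolding of_real_rc_re ip_commute[of y x, symmetric] ip_commute[of x y, symmetric]
      by (rule add.commute)
  qed
  show "re_ip (x + y) z = re_ip x z + re_ip y z"
    by (simp add: re_ip_def ip_add_left rc_re_add)
  show "re_ip (r *\<^sub>R x) y = r * re_ip x y"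
    by (simp add: re_ip_def ip_scaleR_left rc_re_of_real_mult)
  show "0 \<le> re_ip x x" by (simp add: re_ip_self)
qed

lemma re_ip_le_norm: "\<bar>re_ip x y\<bar> \<le> norm x * norm y"
proof (rule power2_le_imp_le)
  show "\<bar>re_ip x y\<bar>\<^sup>2 \<le> (norm x * norm y)\<^sup>2"
    using re.cauchy_schwarz[of x y] by (simp add: re_ip_self power_mult_distrib)
qed simp

lemma bounded_linear_re_ip: "bounded_linear (\<lambda>x. re_ip x y)"
  by (rule bounded_linear_intro[where K="norm y"])
    (use re_ip_le_norm in \<open>simp_all add: re.expand\<close>)

lemma eq_if_re_ip_eq:
  assumes "\<And>z. re_ip x z = re_ip y z"
  shows "x = y"
  using assms[of "x - y"] re_ip_self[of "x - y"] by (simp add: re.diff_left)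

lemma ip_eq_0_if_re_ip_smul_eq_0:
  assumes "\<And>c. re_ip (smul c x) y = 0"
  shows "ip x y = 0"
  by (rule eq_0_if_rc_re_mult_eq_0) (use assms in \<open>simp add: re_ip_def ip_smul_left\<close>)

lemma subspace_real:
  assumes "subspace S"
  shows "real_vector.subspace S"
  using assms by (auto simp: real_vector.subspace_def subspace_def simp flip: smul_of_real)

text \<open>Completeness gives the minimising sequence a limit and closedness keeps it in S.\<close>

lemma riesz:
  assumes S: "real_vector.subspace S" "closed S" and l: "bounded_linear l"
  obtains y where "y \<in> S" "\<And>z. z \<in> S \<Longrightarrow> re_ip y z = l z"
proof -
  interpret l: bounded_linear l by fact
  obtain C where C: "C \<ge> 0" "\<And>x. norm (l x) \<le> norm x * C"
    using l.nonneg_bounded by blast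
  have "l x \<le> C * sqrt (re_ip x x)" for x
    using C(2)[of x] by (simp add: re_ip_self mult.commute)
  then obtain y where y: "\<And>n. y n \<in> S"
    and cauchy: "\<And>n m. n \<le> m \<Longrightarrow> re_ip (y n - y m) (y n - y m) \<le> 4 / (real n + 1)"
    and lim: "\<And>z. z \<in> S \<Longrightarrow> (\<lambda>n. re_ip (y n) z) \<longlonglongrightarrow> l z"
    by (rule re.riesz_sequence[OF S(1) l.linear_axioms C(1)]) blast
  have "Cauchy y"
    by (rule Cauchy_if_norm_diff_sq_le) (use cauchy in \<open>simp add: re_ip_self\<close>)
  then obtain y' where y': "y \<longlonglongrightarrow> y'"
    by (auto simp: Cauchy_convergent_iff convergent_def)
  have "y' \<in> S"
    using S(2) y y' by (auto simp: closed_sequential_limits)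
  moreover have "re_ip y' z = l z" if "z \<in> S" for z
    using bounded_linear.tendsto[OF bounded_linear_re_ip y'] lim[OF that] by (rule LIMSEQ_unique)
  ultimately show thesis using that by blast
qed

section \<open>Orthogonal projections\<close>

lemma orth_proj_unique:
  assumes "subspace S" "y \<in> S" "y' \<in> S"
    and "\<And>w. w \<in> S \<Longrightarrow> ip (f - y) w = 0" "\<And>w. w \<in> S \<Longrightarrow> ip (f - y') w = 0"
  shows "y' = y"
proof -
  have "y - y' \<in> S" using assms(1-3) by (rule subspace_diff)
  then have "ip (y - y') (y - y') = 0"
    using assms(4,5)[of "y - y'"] by (simp add: ip_diff_left)
  then show ?thesis by (simp add: ip_self)
qed

text \<open>Riesz on S, for the functional pairing with f, yields the projection;
  \<open>orth_proj_unique\<close> then resolves the definite description.\<close>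

lemma orth_proj_props:
  assumes S: "subspace S" "closed S"
  shows orth_proj_in: "orth_proj ip S f \<in> S"
    and orth_proj_orthogonal: "w \<in> S \<Longrightarrow> ip (f - orth_proj ip S f) w = 0"
proof -
  obtain y where y: "y \<in> S" "\<And>z. z \<in> S \<Longrightarrow> re_ip y z = re_ip z f"
    by (rule riesz[OF subspace_real[OF S(1)] S(2) bounded_linear_re_ip[of f]]) blast
  have "ip (f - y) w = 0" if "w \<in> S" for w
  proof -
    \<comment> \<open>S contains \<open>smul c w\<close> for each c, so real orthogonality extends
      to all scalar multiples of w.\<close>
    have "re_ip (smul c w) (f - y) = 0" for c
      using y(2)[OF subspace_scale[OF S(1) that, of c]] re.commute[of "smul c w" y]
      by (simp add: re.diff_right)
    then have "ip w (f - y) = 0" by (rule ip_eq_0_if_re_ip_smul_eq_0)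
    then show ?thesis by (rule ip_eq_0_commute)
  qed
  note orthogonal = this
  have "orth_proj ip S f = y"
    unfolding orth_proj_def
  proof (rule the_equality)
    fix y' assume "y' \<in> S \<and> (\<forall>w\<in>S. ip (f - y') w = 0)"
    then show "y' = y"
      using orth_proj_unique[OF S(1) y(1), of y' f] orthogonal by simp
  qed (use y(1) orthogonal in simp)
  then show "orth_proj ip S f \<in> S" "w \<in> S \<Longrightarrow> ip (f - orth_proj ip S f) w = 0"
    using y(1) orthogonal by simp_all
qed

lemma re_ip_orth_proj:
  assumes "subspace S" "closed S" "w \<in> S"
  shows "re_ip w (orth_proj ip S f) = re_ip w f"
proof -
  have "re_ip (f - orth_proj ip S f) w = 0"
    using orth_proj_orthogonal[OF assms, of f] rc_re_of_real[of 0, where 'k='k]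
    by (simp add: re_ip_def)
  then show ?thesis using re.commute[of w] by (simp add: re.diff_left)
qed

text \<open>By uniqueness, since the combined images have the defining property. Real linearity is
  what the frame form uses.\<close>

lemma orth_proj_linear:
  assumes S: "subspace S" "closed S"
  shows "linear (orth_proj ip S)"
proof
  fix f g :: 'a and r :: real
  note real = subspace_real[OF S(1)]
  show "orth_proj ip S (f + g) = orth_proj ip S f + orth_proj ip S g"
  proof (rule orth_proj_unique[OF S(1), symmetric])
    fix w assume "w \<in> S"
    then show "ip (f + g - (orth_proj ip S f + orth_proj ip S g)) w = 0"
      using orth_proj_orthogonal[OF S, of w f] orth_proj_orthogonal[OF S, of w g]
      by (simp add: ip_diff_left ip_add_left)
  qed (use S orth_proj_in orth_proj_orthogonal subspace_add in auto)
  show "orth_proj ip S (r *\<^sub>R f) = r *\<^sub>R orth_proj ip S f"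
  proof (rule orth_proj_unique[OF S(1), symmetric])
    fix w assume "w \<in> S"
    then show "ip (r *\<^sub>R f - r *\<^sub>R orth_proj ip S f) w = 0"
      using orth_proj_orthogonal[OF S, of w f]
      by (simp add: ip_diff_left ip_scaleR_left)
  qed (use S orth_proj_in orth_proj_orthogonal real_vector.subspace_scale[OF real] in auto)
qed

section \<open>Adjoints of bounded operators\<close>

lemma bounded_operator_imp_bounded_linear:
  assumes "bounded_operator smul K"
  shows "bounded_linear K"
proof -
  interpret K: Vector_Spaces.linear smul smul K
    using assms by (simp add: bounded_operator_def)
  obtain M where M: "\<And>x. norm (K x) \<le> M * norm x"
    using assms by (auto simp: bounded_operator_def)
  show ?thesis
    by (rule bounded_linear_intro[where K=M])
      (use M in \<open>simp_all add: K.add K.scale mult.commute flip: smul_of_real\<close>)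
qed

text \<open>Riesz on the whole space gives the adjoint vector for \<open>re_ip\<close>; linearity of
  K over the full field upgrades it to \<open>ip\<close>, and definiteness makes it unique, so the
  definite description is meaningful.\<close>

lemma re_ip_hilbert_adjoint:
  assumes "bounded_operator smul K"
  shows "re_ip (K x) y = re_ip x (hilbert_adjoint ip K y)"
proof -
  interpret K: Vector_Spaces.linear smul smul K
    using assms by (simp add: bounded_operator_def)
  have "\<exists>z. \<forall>x. ip (K x) y = ip x z" for y
  proof -
    have "bounded_linear (\<lambda>x. re_ip (K x) y)"
      by (rule bounded_linear_compose[OF bounded_linear_re_ip bounded_operator_imp_bounded_linear[OF assms]])
    then obtain z where z: "\<And>x. re_ip z x = re_ip (K x) y"
      using riesz[OF real_vector.subspace_UNIV closed_UNIV] by auto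
    have "ip (K x) y = ip x z" for x
    proof -
      \<comment> \<open>Replacing x by \<open>smul c x\<close> moves an arbitrary factor c out of
        the inner product, so the real identity can be tested against every c.\<close>
      have "rc_re (c * (ip x z - ip (K x) y)) = 0" for c
      proof -
        have "c * (ip x z - ip (K x) y) + ip (K (smul c x)) y = ip (smul c x) z"
          by (simp add: K.scale ip_smul_left algebra_simps)
        then have "rc_re (c * (ip x z - ip (K x) y)) + re_ip (K (smul c x)) y = re_ip (smul c x) z"
          by (metis re_ip_def rc_re_add)
        then show ?thesis using z[of "smul c x"] re.commute[of z] by simp
      qed
      then have "ip x z - ip (K x) y = 0" by (rule eq_0_if_rc_re_mult_eq_0)
      then show ?thesis by simp
    qed
    then show ?thesis by blast
  qed
  then have "\<exists>L. \<forall>y x. ip (K x) y = ip x (L y)"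
    by (intro choice allI)
  then obtain L where L: "\<And>x y. ip (K x) y = ip x (L y)" by blast
  have "hilbert_adjoint ip K = L"
    unfolding hilbert_adjoint_def
  proof (rule the_equality)
    fix L' assume L': "\<forall>x y. ip (K x) y = ip x (L' y)"
    show "L' = L"
    proof
      fix y
      have "ip (L' y - L y) (L' y - L y) = 0"
        using L[of "L' y - L y" y] L' by (simp add: ip_diff_right)
      then show "L' y = L y" by (simp add: ip_self)
    qed
  qed (simp add: L)
  then show ?thesis by (simp add: re_ip_def L)
qed

end

section \<open>Boundedness of the synthesis operator\<close>

lemma L2_set_mono_set: "finite B \<Longrightarrow> A \<subseteq> B \<Longrightarrow> L2_set f A \<le> L2_set f B"
  unfolding L2_set_def by (intro real_sqrt_le_mono sum_mono2) auto

text \<open>Cauchy-Schwarz with a constant depending on F: synthesis is bounded on families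
  supported in a fixed finite set, so unboundedness survives off it.\<close>

lemma norm_weighted_sum_le:
  fixes f :: "'i \<Rightarrow> 'a::real_normed_vector"
  shows "norm (\<Sum>i\<in>F. v i *\<^sub>R f i) \<le> L2_set v F * L2_set (\<lambda>i. norm (f i)) F"
proof -
  have "norm (\<Sum>i\<in>F. v i *\<^sub>R f i) \<le> (\<Sum>i\<in>F. \<bar>v i\<bar> * \<bar>norm (f i)\<bar>)"
    by (rule order_trans[OF norm_sum]) simp
  also have "\<dots> \<le> L2_set v F * L2_set (\<lambda>i. norm (f i)) F"
    by (rule L2_set_mult_ineq)
  finally show ?thesis .
qed

text \<open>By induction on H, taking the larger of two stages at each step. It locates a finite set
  relative to the growing supports of the humps.\<close>

lemma incseq_finite_subset:
  assumes "incseq G" "finite H"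
  shows "\<exists>N::nat. H \<inter> (\<Union>n. G n) \<subseteq> G N"
  using \<open>finite H\<close>
proof induction
  case (insert x H)
  then obtain N where N: "H \<inter> (\<Union>n. G n) \<subseteq> G N" by blast
  show ?case
  proof (cases "x \<in> (\<Union>n. G n)")
    case True
    then obtain k where "x \<in> G k" by blast
    moreover have "G k \<subseteq> G (max k N)" "G N \<subseteq> G (max k N)"
      using incseqD[OF \<open>incseq G\<close>, of _ "max k N"] by simp_all
    ultimately show ?thesis using N by (intro exI[of _ "max k N"]) blast
  qed (use N in blast)
qed simp

text \<open>A gliding hump: were the synthesis operator unbounded, it would be so on families supported
  off any given finite set, and a sum of small disjointly supported families with large images
  would be a square-summable family whose synthesis series diverges.\<close>

lemma synthesis_bounded:
  fixes W :: "'i \<Rightarrow> 'a::banach set"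
  assumes W: "\<And>i. i \<in> I \<Longrightarrow> subspace (W i)"
    and summ: "\<And>f. f \<in> l2_sum I W \<Longrightarrow> (\<lambda>i. v i *\<^sub>R f i) summable_on I"
  shows "\<exists>M\<ge>0. \<forall>F f. finite F \<and> F \<subseteq> I \<and> (\<forall>i\<in>F. f i \<in> W i) \<longrightarrow>
    norm (\<Sum>i\<in>F. v i *\<^sub>R f i) \<le> M * L2_set (\<lambda>i. norm (f i)) F"
proof (rule ccontr)
  assume unbounded: "\<not> ?thesis"
  \<comment> \<open>Geometric energy makes the sum of the humps square-summable; images of norm at
    least 1 violate the Cauchy criterion.\<close>
  define hump where "hump G n F f \<longleftrightarrow> finite F \<and> F \<subseteq> I - G \<and> (\<forall>i\<in>F. f i \<in> W i) \<and>
      (\<Sum>i\<in>F. (norm (f i))\<^sup>2) \<le> (1/2) ^ n \<and> 1 \<le> norm (\<Sum>i\<in>F. v i *\<^sub>R f i)"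
    for G F f and n :: nat
  have hump_ex: "\<exists>F f. hump G n F f" if G: "finite G" for G n
  proof -
    \<comment> \<open>The first summand pays for the part of f inside G, leaving the factor
      \<open>2 ^ n\<close> for the part outside.\<close>
    have "L2_set v G + 2 ^ n \<ge> 0" by simp
    then obtain F f where F: "finite F" "F \<subseteq> I" "\<forall>i\<in>F. f i \<in> W i"
      and large: "(L2_set v G + 2 ^ n) * L2_set (\<lambda>i. norm (f i)) F < norm (\<Sum>i\<in>F. v i *\<^sub>R f i)"
      using unbounded by (meson not_le)
    define L where "L = L2_set (\<lambda>i. norm (f i)) F"
    define s where "s = norm (\<Sum>i\<in>F - G. v i *\<^sub>R f i)"
    have L: "L \<ge> 0" by (simp add: L_def)
    have "(\<Sum>i\<in>F. v i *\<^sub>R f i) = (\<Sum>i\<in>F \<inter> G. v i *\<^sub>R f i) + (\<Sum>i\<in>F - G. v i *\<^sub>R f i)"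
      using F(1) by (rule sum.Int_Diff)
    then have "norm (\<Sum>i\<in>F. v i *\<^sub>R f i) \<le> norm (\<Sum>i\<in>F \<inter> G. v i *\<^sub>R f i) + s"
      unfolding s_def by (metis norm_triangle_ineq)
    also have "norm (\<Sum>i\<in>F \<inter> G. v i *\<^sub>R f i)
        \<le> L2_set v (F \<inter> G) * L2_set (\<lambda>i. norm (f i)) (F \<inter> G)"
      by (rule norm_weighted_sum_le)
    also have "\<dots> \<le> L2_set v G * L"
      unfolding L_def using G F(1) by (intro mult_mono L2_set_mono_set) auto
    finally have s: "2 ^ n * L < s"
      using large by (simp add: L_def algebra_simps)
    have "0 \<le> 2 ^ n * L" using L by simp
    then have s0: "s > 0" using s by linarith
    \<comment> \<open>Normalised so that the image off G has norm 1; the energy is then at most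
      \<open>1 / 4 ^ n\<close>, weakened to \<open>(1/2) ^ n\<close>.\<close>
    define g where "g i = (1 / s) *\<^sub>R f i" for i
    have "(\<Sum>i\<in>F - G. v i *\<^sub>R g i) = (1 / s) *\<^sub>R (\<Sum>i\<in>F - G. v i *\<^sub>R f i)"
      by (simp add: g_def scaleR_sum_right mult.commute)
    then have "norm (\<Sum>i\<in>F - G. v i *\<^sub>R g i) = 1"
      using s0 by (simp add: s_def)
    moreover have "(\<Sum>i\<in>F - G. (norm (g i))\<^sup>2) \<le> (1/2) ^ n"
    proof -
      have "(\<Sum>i\<in>F - G. (norm (g i))\<^sup>2) = (\<Sum>i\<in>F - G. (norm (f i))\<^sup>2) / s\<^sup>2"
        using s0 by (simp add: g_def power_divide sum_divide_distrib)
      also have "\<dots> \<le> L\<^sup>2 / s\<^sup>2"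
      proof (rule divide_right_mono)
        have "(\<Sum>i\<in>F - G. (norm (f i))\<^sup>2) \<le> (\<Sum>i\<in>F. (norm (f i))\<^sup>2)"
          using F(1) by (intro sum_mono2) auto
        also have "\<dots> = L\<^sup>2" by (simp add: L_def L2_set_def sum_nonneg)
        finally show "(\<Sum>i\<in>F - G. (norm (f i))\<^sup>2) \<le> L\<^sup>2" .
      qed simp
      also have "\<dots> \<le> (1/2) ^ n"
      proof -
        have "L\<^sup>2 * 2 ^ n \<le> L\<^sup>2 * (2 ^ n)\<^sup>2"
          by (intro mult_left_mono self_le_power) simp_all
        also have "\<dots> = (2 ^ n * L)\<^sup>2" by (simp add: power_mult_distrib)
        also have "\<dots> \<le> s\<^sup>2" using s \<open>0 \<le> 2 ^ n * L\<close> by (intro power_mono) auto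
        finally show ?thesis using s0 by (simp add: divide_simps power_one_over)
      qed
      finally show ?thesis .
    qed
    moreover have "\<forall>i\<in>F - G. g i \<in> W i"
      using F W by (auto simp: g_def intro: subspace_scale)
    ultimately have "hump G n (F - G) g" using F by (auto simp: hump_def)
    then show ?thesis by blast
  qed
  \<comment> \<open>Support and family are chosen separately, so the recursion for G has to track
    supports only.\<close>
  define \<Phi> where "\<Phi> G n = (SOME F. \<exists>f. hump G n F f)" for G n
  define \<phi> where "\<phi> G n = (SOME f. hump G n (\<Phi> G n) f)" for G n
  have hump: "hump G n (\<Phi> G n) (\<phi> G n)" if "finite G" for G n
    unfolding \<phi>_def
  proof (rule someI_ex[where P="hump G n (\<Phi> G n)"])
    show "\<exists>f. hump G n (\<Phi> G n) f"
      unfolding \<Phi>_def using hump_ex[OF that] by (rule someI_ex[where P="\<lambda>F. \<exists>f. hump G n F f"])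
  qed
  \<comment> \<open>\<open>G n\<close> joins the supports of the humps before n, which keeps hump n
    disjoint from them.\<close>
  define G where "G = rec_nat {} (\<lambda>n G. G \<union> \<Phi> G n)"
  have G_simps: "G 0 = {}" "\<And>n. G (Suc n) = G n \<union> \<Phi> (G n) n" by (simp_all add: G_def)
  have finG: "finite (G n)" for n
    by (induction n) (use hump in \<open>auto simp: G_simps hump_def\<close>)
  have \<Phi>_finite: "finite (\<Phi> (G n) n)" and \<Phi>_subset: "\<Phi> (G n) n \<subseteq> I - G n"
    and \<phi>_in: "\<And>i. i \<in> \<Phi> (G n) n \<Longrightarrow> \<phi> (G n) n i \<in> W i"
    and \<phi>_small: "(\<Sum>i\<in>\<Phi> (G n) n. (norm (\<phi> (G n) n i))\<^sup>2) \<le> (1/2) ^ n"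
    and \<phi>_large: "1 \<le> norm (\<Sum>i\<in>\<Phi> (G n) n. v i *\<^sub>R \<phi> (G n) n i)" for n
    using hump[OF finG[of n], of n] by (simp_all add: hump_def)
  have incG: "incseq G"
    by (rule incseq_SucI) (simp add: G_simps)
  let ?F = "\<lambda>n. \<Phi> (G n) n"
  have disj: "n = m" if "i \<in> ?F n" "i \<in> ?F m" for i n m
  proof -
    have *: False if "k < l" "i \<in> ?F k" "i \<in> ?F l" for k l
    proof -
      have "i \<in> G (Suc k)" using that by (simp add: G_simps)
      also have "G (Suc k) \<subseteq> G l" by (rule incseqD[OF incG]) (use that in simp)
      finally show False using that \<Phi>_subset[of l] by blast
    qed
    show ?thesis
      using *[of n m] *[of m n] that by (cases n m rule: linorder_cases) simp_all
  qed
  \<comment> \<open>The humps glued together; disjoint supports make the index unique, and 0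
    elsewhere lies in every subspace.\<close>
  define f where "f i = (if \<exists>n. i \<in> ?F n then \<phi> (G (THE n. i \<in> ?F n)) (THE n. i \<in> ?F n) i else 0)"
    for i
  have f_eq: "f i = \<phi> (G n) n i" if "i \<in> ?F n" for i n
  proof -
    have "(THE n. i \<in> ?F n) = n" using that disj by (intro the_equality) auto
    then show ?thesis using that by (auto simp: f_def)
  qed
  have f0: "f i = 0" if "i \<notin> (\<Union>n. G n)" for i
  proof -
    have "i \<notin> ?F n" for n using that G_simps(2)[of n] by blast
    then show ?thesis by (simp add: f_def)
  qed
  \<comment> \<open>The bound is the geometric sum 1 + 1/2 + ... with n terms.\<close>
  have sum_G: "(\<Sum>i\<in>G n. (norm (f i))\<^sup>2) \<le> 2 - 2 * (1/2) ^ n" for n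
  proof (induction n)
    case (Suc n)
    have "(\<Sum>i\<in>G (Suc n). (norm (f i))\<^sup>2)
        = (\<Sum>i\<in>G n. (norm (f i))\<^sup>2) + (\<Sum>i\<in>?F n. (norm (f i))\<^sup>2)"
      unfolding G_simps using finG \<Phi>_finite \<Phi>_subset by (intro sum.union_disjoint) auto
    also have "(\<Sum>i\<in>?F n. (norm (f i))\<^sup>2) = (\<Sum>i\<in>?F n. (norm (\<phi> (G n) n i))\<^sup>2)"
      by (intro sum.cong) (simp_all add: f_eq)
    also have "\<dots> \<le> (1/2) ^ n" by (rule \<phi>_small)
    finally show ?case using Suc by simp
  qed (simp add: G_simps)
  have "(\<lambda>i. (norm (f i))\<^sup>2) summable_on I"
  proof (rule nonneg_bdd_above_summable_on)
    have "(\<Sum>i\<in>H. (norm (f i))\<^sup>2) \<le> 2" if "finite H" for H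
    proof -
      obtain N where N: "H \<inter> (\<Union>n. G n) \<subseteq> G N"
        using incseq_finite_subset[OF incG \<open>finite H\<close>] by blast
      have "(\<Sum>i\<in>H. (norm (f i))\<^sup>2) = (\<Sum>i\<in>H \<inter> (\<Union>n. G n). (norm (f i))\<^sup>2)"
        using that f0 by (intro sum.mono_neutral_right) auto
      also have "\<dots> \<le> (\<Sum>i\<in>G N. (norm (f i))\<^sup>2)"
        using N finG by (intro sum_mono2) auto
      also have "\<dots> \<le> 2 - 2 * (1/2) ^ N" by (rule sum_G)
      also have "\<dots> \<le> 2" by simp
      finally show ?thesis .
    qed
    then show "bdd_above (sum (\<lambda>i. (norm (f i))\<^sup>2) ` {F. F \<subseteq> I \<and> finite F})"
      by (intro bdd_aboveI2[where M=2]) auto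
  qed simp
  moreover have "f i \<in> W i" if "i \<in> I" for i
  proof (cases "i \<in> (\<Union>n. ?F n)")
    case True
    then obtain n where "i \<in> ?F n" by blast
    then show ?thesis using \<phi>_in[of i n] f_eq[of i n] by simp
  next
    case False
    then have "f i = 0" by (auto simp: f_def)
    then show ?thesis using W[OF that] by (simp add: subspace_0)
  qed
  ultimately have "f \<in> l2_sum I W" by (simp add: l2_sum_def)
  from summ[OF this] obtain X where X: "finite X"
    and small: "\<And>Y. finite Y \<Longrightarrow> Y \<subseteq> I - X \<Longrightarrow> norm (\<Sum>i\<in>Y. v i *\<^sub>R f i) < 1"
    unfolding summable_on_iff_small_tails by (meson zero_less_one)
  \<comment> \<open>From this stage on the humps avoid X, so the tail estimate applies to hump
    N.\<close>
  obtain N where N: "X \<inter> (\<Union>n. G n) \<subseteq> G N"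
    using incseq_finite_subset[OF incG X] by blast
  have "?F N \<subseteq> I - X"
  proof
    fix i assume i: "i \<in> ?F N"
    then have "i \<in> G (Suc N)" "i \<in> I" "i \<notin> G N" using \<Phi>_subset[of N] by (auto simp: G_simps)
    then show "i \<in> I - X" using N by blast
  qed
  then have "norm (\<Sum>i\<in>?F N. v i *\<^sub>R f i) < 1" by (intro small \<Phi>_finite)
  moreover have "(\<Sum>i\<in>?F N. v i *\<^sub>R f i) = (\<Sum>i\<in>?F N. v i *\<^sub>R \<phi> (G N) N i)"
    by (intro sum.cong) (simp_all add: f_eq)
  ultimately show False using \<phi>_large[of N] by simp
qed

section \<open>Weighted families of subspaces\<close>

locale weighted_subspaces = hilbert_space smul ip
  for smul :: "'k::rc_field \<Rightarrow> 'a::banach \<Rightarrow> 'a" and ip :: "'a \<Rightarrow> 'a \<Rightarrow> 'k" +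
  fixes I :: "'i set" and W :: "'i \<Rightarrow> 'a set" and v :: "'i \<Rightarrow> real"
  assumes subspaces: "i \<in> I \<Longrightarrow> subspace (W i)"
    and closed_subspaces: "i \<in> I \<Longrightarrow> closed (W i)"
begin

text \<open>The i-th component of the analysis operator, the adjoint of synthesis.\<close>

definition coef :: "'i \<Rightarrow> 'a \<Rightarrow> 'a"
  where "coef i x = v i *\<^sub>R orth_proj ip (W i) x"

text \<open>Finite sections keep summability out of the definition. B bounds norms, so its square is
  the constant for sums of squares.\<close>

definition bessel_bound :: "real \<Rightarrow> bool"
  where "bessel_bound B \<longleftrightarrow>
    (\<forall>F x. finite F \<and> F \<subseteq> I \<longrightarrow> L2_set (\<lambda>i. norm (coef i x)) F \<le> B * norm x)"

lemma norm_coef: "(norm (coef i x))\<^sup>2 = (v i)\<^sup>2 * (norm (orth_proj ip (W i) x))\<^sup>2"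
  by (simp add: coef_def power_mult_distrib)

lemma real_subspaces: "i \<in> I \<Longrightarrow> real_vector.subspace (W i)"
  by (intro subspace_real subspaces)

lemma coef_in: "i \<in> I \<Longrightarrow> coef i x \<in> W i"
  unfolding coef_def
  by (intro real_vector.subspace_scale real_subspaces orth_proj_in subspaces closed_subspaces)

lemma linear_coef: "i \<in> I \<Longrightarrow> linear (coef i)"
  using linear_compose_scale_right[OF orth_proj_linear[OF subspaces closed_subspaces]]
  by (simp add: coef_def[abs_def])

section \<open>Duality between synthesis and analysis\<close>

lemma re_ip_coef: "i \<in> I \<Longrightarrow> w \<in> W i \<Longrightarrow> re_ip w (coef i x) = v i * re_ip w x"
  by (simp add: coef_def re.scale_right re_ip_orth_proj[OF subspaces closed_subspaces])

text \<open>The adjoint relation for finite supports; since \<open>f i\<close> lies in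
  \<open>W i\<close>, pairing it with x or with the projection of x is the same.\<close>

lemma re_ip_weighted_sum:
  assumes "F \<subseteq> I" "\<And>i. i \<in> F \<Longrightarrow> f i \<in> W i"
  shows "re_ip (\<Sum>i\<in>F. v i *\<^sub>R f i) x = (\<Sum>i\<in>F. re_ip (f i) (coef i x))"
proof -
  interpret r: bounded_linear "\<lambda>y. re_ip y x" by (rule bounded_linear_re_ip)
  show ?thesis
    unfolding r.sum by (intro sum.cong) (use assms in \<open>auto simp: re_ip_coef re.scale_left\<close>)
qed

lemma sum_re_ip_le:
  "(\<Sum>i\<in>F. re_ip (f i) (g i)) \<le> L2_set (\<lambda>i. norm (f i)) F * L2_set (\<lambda>i. norm (g i)) F"
proof -
  have "(\<Sum>i\<in>F. re_ip (f i) (g i)) \<le> (\<Sum>i\<in>F. \<bar>norm (f i)\<bar> * \<bar>norm (g i)\<bar>)"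
    by (intro sum_mono) (use re_ip_le_norm abs_le_D1 in auto)
  also have "\<dots> \<le> L2_set (\<lambda>i. norm (f i)) F * L2_set (\<lambda>i. norm (g i)) F"
    by (rule L2_set_mult_ineq)
  finally show ?thesis .
qed

text \<open>Synthesise the coefficients of x themselves: their squared norm is the inner product of
  that sum with x, and one factor cancels.\<close>

lemma bessel_bound_if_synthesis_bound:
  assumes M: "M \<ge> 0" "\<And>F f. finite F \<Longrightarrow> F \<subseteq> I \<Longrightarrow> (\<And>i. i \<in> F \<Longrightarrow> f i \<in> W i) \<Longrightarrow>
    norm (\<Sum>i\<in>F. v i *\<^sub>R f i) \<le> M * L2_set (\<lambda>i. norm (f i)) F"
  shows "bessel_bound M"
  unfolding bessel_bound_def
proof (intro allI impI)
  fix F x assume F: "finite F \<and> F \<subseteq> I"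
  let ?s = "\<Sum>i\<in>F. v i *\<^sub>R coef i x"
  let ?p = "L2_set (\<lambda>i. norm (coef i x)) F"
  have c: "coef i x \<in> W i" if "i \<in> F" for i using that F coef_in by blast
  have "?p * ?p = (\<Sum>i\<in>F. re_ip (coef i x) (coef i x))"
    by (simp add: L2_set_def re_ip_self sum_nonneg)
  also have "\<dots> = re_ip ?s x" using F c by (simp add: re_ip_weighted_sum)
  also have "\<dots> \<le> norm ?s * norm x" using re_ip_le_norm abs_le_D1 by blast
  also have "\<dots> \<le> (M * ?p) * norm x"
    using F c by (intro mult_right_mono M(2)) auto
  finally have "?p * ?p \<le> (M * norm x) * ?p" by (simp add: mult_ac)
  then show "?p \<le> M * norm x"
    using M(1) L2_set_nonneg[of "\<lambda>i. norm (coef i x)" F]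
    by (cases "?p = 0") (auto simp: mult_le_cancel_right)
qed

text \<open>The dual argument: pair the sum with itself and turn one copy into its
  coefficients.\<close>

lemma synthesis_bound_if_bessel_bound:
  assumes B: "bessel_bound B" and F: "finite F" "F \<subseteq> I" "\<And>i. i \<in> F \<Longrightarrow> f i \<in> W i"
  shows "norm (\<Sum>i\<in>F. v i *\<^sub>R f i) \<le> B * L2_set (\<lambda>i. norm (f i)) F"
proof -
  let ?s = "\<Sum>i\<in>F. v i *\<^sub>R f i"
  let ?L = "L2_set (\<lambda>i. norm (f i)) F"
  have p: "L2_set (\<lambda>i. norm (coef i ?s)) F \<le> B * norm ?s"
    using B F by (auto simp: bessel_bound_def)
  have "norm ?s * norm ?s = (\<Sum>i\<in>F. re_ip (f i) (coef i ?s))"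
    using re_ip_self[of ?s] F by (simp add: re_ip_weighted_sum power2_eq_square)
  also have "\<dots> \<le> ?L * L2_set (\<lambda>i. norm (coef i ?s)) F" by (rule sum_re_ip_le)
  also have "\<dots> \<le> ?L * (B * norm ?s)" using p by (intro mult_left_mono) auto
  finally have *: "norm ?s * norm ?s \<le> (B * ?L) * norm ?s" by (simp add: mult_ac)
  show ?thesis
  proof (cases "norm ?s = 0")
    case True
    \<comment> \<open>The sign of B is not given. If some \<open>f i\<close> is nonzero, the empty
      section in the Bessel bound at \<open>f i\<close> yields
      \<open>0 \<le> B * norm (f i)\<close>.\<close>
    have "0 \<le> B * ?L"
    proof (cases "?L = 0")
      case False
      then obtain i where "i \<in> F" "f i \<noteq> 0" using F by (auto simp: L2_set_eq_0_iff)
      then have "0 \<le> B * norm (f i)"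
        using B by (auto simp: bessel_bound_def intro: order_trans[OF L2_set_nonneg[of _ "{}"]])
      then show ?thesis using \<open>f i \<noteq> 0\<close> by (simp add: zero_le_mult_iff)
    qed simp
    then show ?thesis using True by simp
  next
    case False
    then show ?thesis using * by (simp add: mult_le_cancel_right)
  qed
qed

text \<open>The uniform synthesis bound carries small tails of the squared norms over to the
  weighted series, and the Cauchy criterion applies.\<close>

lemma weighted_summable_if_bessel_bound:
  assumes B: "bessel_bound B" and f: "f \<in> l2_sum I W"
  shows "(\<lambda>i. v i *\<^sub>R f i) summable_on I"
  unfolding summable_on_iff_small_tails
proof (intro allI impI)
  fix e :: real assume e: "e > 0"
  \<comment> \<open>Chosen so that \<open>sqrt d * (\<bar>B\<bar> + 1)\<close> equals e; the 1
    covers B = 0.\<close>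
  define d where "d = (e / (\<bar>B\<bar> + 1))\<^sup>2"
  have "d > 0" using e by (simp add: d_def)
  moreover have "(\<lambda>i. (norm (f i))\<^sup>2) summable_on I" using f by (simp add: l2_sum_def)
  ultimately obtain X where X: "finite X" "X \<subseteq> I"
    and small: "\<And>Y. finite Y \<Longrightarrow> Y \<subseteq> I - X \<Longrightarrow> norm (\<Sum>i\<in>Y. (norm (f i))\<^sup>2) < d"
    unfolding summable_on_iff_small_tails by meson
  have "norm (\<Sum>i\<in>Y. v i *\<^sub>R f i) < e" if Y: "finite Y" "Y \<subseteq> I - X" for Y
  proof -
    let ?L = "L2_set (\<lambda>i. norm (f i)) Y"
    have "?L < sqrt d"
      using small[OF Y] unfolding L2_set_def by (intro real_sqrt_less_mono) simp
    also have "sqrt d = e / (\<bar>B\<bar> + 1)" using e by (simp add: d_def)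
    finally have "?L * (\<bar>B\<bar> + 1) < e" by (subst (asm) pos_less_divide_eq) auto
    moreover have "norm (\<Sum>i\<in>Y. v i *\<^sub>R f i) \<le> B * ?L"
      using Y f by (intro synthesis_bound_if_bessel_bound[OF B]) (auto simp: l2_sum_def)
    moreover have "B * ?L \<le> (\<bar>B\<bar> + 1) * ?L" by (intro mult_right_mono) auto
    ultimately show ?thesis by (simp add: mult.commute)
  qed
  then show "\<exists>X. finite X \<and> X \<subseteq> I \<and>
      (\<forall>Y. finite Y \<and> Y \<subseteq> I - X \<longrightarrow> norm (\<Sum>i\<in>Y. v i *\<^sub>R f i) < e)"
    using X by blast
qed

lemma L2_set_le_infsum:
  assumes "(\<lambda>i. (norm (f i))\<^sup>2) summable_on I" "finite F" "F \<subseteq> I"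
  shows "L2_set (\<lambda>i. norm (f i)) F \<le> sqrt (\<Sum>\<^sub>\<infinity>i\<in>I. (norm (f i))\<^sup>2)"
  unfolding L2_set_def using assms by (intro real_sqrt_le_mono finite_sum_le_infsum) auto

lemma summable_norm_coef_if_bessel_bound:
  assumes "bessel_bound B"
  shows "(\<lambda>i. (norm (coef i x))\<^sup>2) summable_on I"
    and "(\<Sum>\<^sub>\<infinity>i\<in>I. (norm (coef i x))\<^sup>2) \<le> (B * norm x)\<^sup>2"
proof -
  have le: "(\<Sum>i\<in>F. (norm (coef i x))\<^sup>2) \<le> (B * norm x)\<^sup>2" if "finite F" "F \<subseteq> I" for F
  proof -
    have "L2_set (\<lambda>i. norm (coef i x)) F \<le> B * norm x"
      using assms that by (simp add: bessel_bound_def)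
    then have "(L2_set (\<lambda>i. norm (coef i x)) F)\<^sup>2 \<le> (B * norm x)\<^sup>2"
      by (intro power_mono) auto
    then show ?thesis by (simp add: L2_set_def sum_nonneg)
  qed
  show "(\<lambda>i. (norm (coef i x))\<^sup>2) summable_on I"
    by (intro nonneg_bdd_above_summable_on bdd_aboveI2[where M="(B * norm x)\<^sup>2"])
      (use le in auto)
  then show "(\<Sum>\<^sub>\<infinity>i\<in>I. (norm (coef i x))\<^sup>2) \<le> (B * norm x)\<^sup>2"
    by (rule infsum_le_finite_sums) (rule le)
qed

lemma re_ip_has_sum:
  assumes "((\<lambda>i. v i *\<^sub>R f i) has_sum s) I" "\<And>i. i \<in> I \<Longrightarrow> f i \<in> W i"
  shows "((\<lambda>i. re_ip (f i) (coef i x)) has_sum re_ip s x) I"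
proof -
  have "((\<lambda>i. re_ip (v i *\<^sub>R f i) x) has_sum re_ip s x) I"
    using bounded_linear_re_ip assms(1) by (rule has_sum_bounded_linear)
  then show ?thesis
    by (rule has_sum_cong[THEN iffD1, rotated]) (simp add: re_ip_coef assms(2) re.scale_left)
qed

lemma l2_norm_eq:
  assumes "f \<in> l2_sum I W"
  shows "l2_norm ip I f = sqrt (\<Sum>\<^sub>\<infinity>i\<in>I. (norm (f i))\<^sup>2)"
proof -
  have "((\<lambda>i. (norm (f i))\<^sup>2) has_sum (\<Sum>\<^sub>\<infinity>i\<in>I. (norm (f i))\<^sup>2)) I"
    using assms by (simp add: l2_sum_def)
  then have "((\<lambda>i. ip (f i) (f i)) has_sum of_real (\<Sum>\<^sub>\<infinity>i\<in>I. (norm (f i))\<^sup>2)) I"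
    unfolding ip_self by (rule has_sum_of_real)
  then show ?thesis
    by (simp add: l2_norm_def l2_ip_def infsumI rc_re_of_real)
qed

section \<open>From atomic subspaces to the two inequalities\<close>

lemma atomic_imp_bounds:
  assumes K: "bounded_operator smul K" and atomic: "atomic_subspace ip I W v K"
  shows "\<exists>A>0. \<exists>B. bessel_bound B \<and>
    (\<forall>x. A * (norm (hilbert_adjoint ip K x))\<^sup>2 \<le> (\<Sum>\<^sub>\<infinity>i\<in>I. (norm (coef i x))\<^sup>2))"
proof -
  from atomic obtain C where C: "C > 0"
    and rep: "\<And>x. \<exists>f\<in>l2_sum I W. ((\<lambda>i. v i *\<^sub>R f i) has_sum K x) I \<and> l2_norm ip I f \<le> C * norm x"
    by (auto simp: atomic_subspace_def)
  have "\<exists>M\<ge>0. \<forall>F f. finite F \<and> F \<subseteq> I \<and> (\<forall>i\<in>F. f i \<in> W i) \<longrightarrow>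
      norm (\<Sum>i\<in>F. v i *\<^sub>R f i) \<le> M * L2_set (\<lambda>i. norm (f i)) F"
    using atomic by (intro synthesis_bounded real_subspaces) (auto simp: atomic_subspace_def)
  then obtain B where B: "bessel_bound B"
    by (elim exE conjE, intro that, intro bessel_bound_if_synthesis_bound) auto
  \<comment> \<open>Representing K at the vector \<open>hilbert_adjoint ip K x\<close> turns the
    squared norm of that vector into a pairing with the coefficients of x. Cancelling one norm
    leaves the factor C, whence the constant \<open>1 / C\<^sup>2\<close>.\<close>
  have "1 / C\<^sup>2 * (norm (hilbert_adjoint ip K x))\<^sup>2 \<le> (\<Sum>\<^sub>\<infinity>i\<in>I. (norm (coef i x))\<^sup>2)" for x
  proof -
    let ?y = "hilbert_adjoint ip K x"
    let ?S = "\<Sum>\<^sub>\<infinity>i\<in>I. (norm (coef i x))\<^sup>2"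
    obtain f where f: "f \<in> l2_sum I W" and s: "((\<lambda>i. v i *\<^sub>R f i) has_sum K ?y) I"
      and le: "l2_norm ip I f \<le> C * norm ?y"
      using rep by blast
    have S: "(\<lambda>i. (norm (coef i x))\<^sup>2) summable_on I"
      by (rule summable_norm_coef_if_bessel_bound[OF B])
    have "norm ?y * norm ?y = re_ip (K ?y) x"
      using re_ip_hilbert_adjoint[OF K, of ?y x] by (simp add: re_ip_self power2_eq_square)
    also have "\<dots> \<le> l2_norm ip I f * sqrt ?S"
    proof (rule has_sum_le_finite_sums)
      show "((\<lambda>i. re_ip (f i) (coef i x)) has_sum re_ip (K ?y) x) I"
        using s f by (intro re_ip_has_sum) (auto simp: l2_sum_def)
      fix F assume F: "finite F" "F \<subseteq> I"
      have "(\<Sum>i\<in>F. re_ip (f i) (coef i x))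
          \<le> L2_set (\<lambda>i. norm (f i)) F * L2_set (\<lambda>i. norm (coef i x)) F"
        by (rule sum_re_ip_le)
      also have "\<dots> \<le> l2_norm ip I f * sqrt ?S"
        unfolding l2_norm_eq[OF f] using f F S
        by (intro mult_mono L2_set_le_infsum)
          (auto simp: l2_sum_def intro!: infsum_nonneg)
      finally show "(\<Sum>i\<in>F. re_ip (f i) (coef i x)) \<le> l2_norm ip I f * sqrt ?S" .
    qed
    also have "\<dots> \<le> (C * norm ?y) * sqrt ?S"
      using le by (intro mult_right_mono) (auto intro!: infsum_nonneg)
    finally have "norm ?y * norm ?y \<le> (C * sqrt ?S) * norm ?y" by (simp add: mult_ac)
    moreover have S0: "0 \<le> ?S" by (intro infsum_nonneg) simp
    ultimately have "norm ?y \<le> C * sqrt ?S"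
      using C by (cases "norm ?y = 0") (auto simp: mult_le_cancel_right)
    then have "(norm ?y)\<^sup>2 \<le> (C * sqrt ?S)\<^sup>2" by (intro power_mono) auto
    also have "\<dots> = C\<^sup>2 * ?S" using S0 by (simp add: power_mult_distrib)
    finally show ?thesis using C by (simp add: divide_le_eq mult.commute)
  qed
  then show ?thesis using B C by (intro exI[of _ "1 / C\<^sup>2"] conjI exI[of _ B]) auto
qed

section \<open>From the two inequalities to atomic subspaces\<close>

lemma summable_re_ip:
  assumes "(\<lambda>i. (norm (f i))\<^sup>2) summable_on I" "(\<lambda>i. (norm (g i))\<^sup>2) summable_on I"
  shows "(\<lambda>i. re_ip (f i) (g i)) summable_on I"
proof -
  have "(\<lambda>i. (norm (f i))\<^sup>2 + (norm (g i))\<^sup>2) summable_on I"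
    using assms by (rule summable_on_add)
  then have "(\<lambda>i. norm (re_ip (f i) (g i))) summable_on I"
  proof (rule summable_on_comparison_test)
    fix i
    have "norm (re_ip (f i) (g i)) \<le> norm (f i) * norm (g i)"
      using re_ip_le_norm by simp
    \<comment> \<open>The mean inequality dominates the pairing by the sum of the two
      squares.\<close>
    moreover have "2 * (norm (f i) * norm (g i)) \<le> (norm (f i))\<^sup>2 + (norm (g i))\<^sup>2"
      using sum_squares_bound[of "norm (f i)" "norm (g i)"] by simp
    moreover have "0 \<le> norm (f i) * norm (g i)" by simp
    ultimately show "norm (re_ip (f i) (g i)) \<le> (norm (f i))\<^sup>2 + (norm (g i))\<^sup>2" by linarith
  qed simp
  then show ?thesis by (rule abs_summable_summable)
qed

text \<open>The bilinear form of the frame operator, synthesis after analysis. A sum that does not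
  converge defaults to 0, so the laws of the form are proved under a Bessel bound.\<close>

definition frame_form :: "'a \<Rightarrow> 'a \<Rightarrow> real"
  where "frame_form y z = (\<Sum>\<^sub>\<infinity>i\<in>I. re_ip (coef i y) (coef i z))"

lemma frame_form_self: "frame_form y y = (\<Sum>\<^sub>\<infinity>i\<in>I. (norm (coef i y))\<^sup>2)"
  by (simp add: frame_form_def re_ip_self)

lemma frame_form_has_sum:
  assumes "bessel_bound B"
  shows "((\<lambda>i. re_ip (coef i y) (coef i z)) has_sum frame_form y z) I"
  unfolding frame_form_def
  by (intro has_sum_infsum summable_re_ip summable_norm_coef_if_bessel_bound[OF assms])

lemma pre_inner_frame_form:
  assumes B: "bessel_bound B"
  shows "pre_inner frame_form"
proof
  fix x y z :: 'a and r :: real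
  show "frame_form x y = frame_form y x"
    using re.commute by (simp add: frame_form_def)
  have "((\<lambda>i. re_ip (coef i x) (coef i z) + re_ip (coef i y) (coef i z))
      has_sum (frame_form x z + frame_form y z)) I"
    by (intro has_sum_add frame_form_has_sum[OF B])
  also have "?this \<longleftrightarrow> ((\<lambda>i. re_ip (coef i (x + y)) (coef i z))
      has_sum (frame_form x z + frame_form y z)) I"
    by (intro has_sum_cong) (simp add: linear_add[OF linear_coef] re.add_left)
  finally show "frame_form (x + y) z = frame_form x z + frame_form y z"
    unfolding frame_form_def[of "x + y"] by (rule infsumI)
  have "((\<lambda>i. r * re_ip (coef i x) (coef i y)) has_sum (r * frame_form x y)) I"
    by (intro has_sum_cmult_right frame_form_has_sum[OF B])
  also have "?this \<longleftrightarrow> ((\<lambda>i. re_ip (coef i (r *\<^sub>R x)) (coef i y)) has_sum (r * frame_form x y)) I"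
    by (intro has_sum_cong) (simp add: linear_scale[OF linear_coef] re.scale_left)
  finally show "frame_form (r *\<^sub>R x) y = r * frame_form x y"
    unfolding frame_form_def[of "r *\<^sub>R x"] by (rule infsumI)
  show "0 \<le> frame_form x x"
    unfolding frame_form_self by (intro infsum_nonneg) simp
qed

text \<open>Douglas' factorisation: the lower bound makes \<open>z \<mapsto> \<langle>K x, z\<rangle>\<close> bounded with respect to the
  frame form, and the coefficients of a representing sequence converge to the required family.\<close>

lemma bounds_imp_representation:
  assumes K: "bounded_operator smul K" and B: "bessel_bound B" and A: "A > 0"
    and lower: "\<And>x. A * (norm (hilbert_adjoint ip K x))\<^sup>2 \<le> (\<Sum>\<^sub>\<infinity>i\<in>I. (norm (coef i x))\<^sup>2)"
  shows "\<exists>f\<in>l2_sum I W. ((\<lambda>i. v i *\<^sub>R f i) has_sum K x) I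
    \<and> l2_norm ip I f \<le> (2 / sqrt A) * norm x"
proof -
  interpret q: pre_inner frame_form using B by (rule pre_inner_frame_form)
  \<comment> \<open>Bounds the functional in the frame form: move K to z by the adjoint and apply
    the lower inequality. The factor 2 in the conclusion comes from
    \<open>riesz_sequence\<close>.\<close>
  define C where "C = norm x / sqrt A"
  have C: "C \<ge> 0" using A by (simp add: C_def)
  have "linear (\<lambda>z. re_ip (K x) z)"
    by (rule linearI) (simp_all add: re.add_right re.scale_right)
  moreover have "re_ip (K x) z \<le> C * sqrt (frame_form z z)" for z
  proof -
    let ?y = "hilbert_adjoint ip K z"
    have "sqrt (A * (norm ?y)\<^sup>2) \<le> sqrt (frame_form z z)"
      unfolding frame_form_self using lower by (rule real_sqrt_le_mono)
    then have y: "norm ?y \<le> sqrt (frame_form z z) / sqrt A"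
      using A by (simp add: real_sqrt_mult field_simps)
    have "re_ip (K x) z \<le> norm x * norm ?y"
      unfolding re_ip_hilbert_adjoint[OF K] using re_ip_le_norm abs_le_D1 by blast
    also have "\<dots> \<le> norm x * (sqrt (frame_form z z) / sqrt A)"
      using y by (intro mult_left_mono) auto
    finally show ?thesis by (simp add: C_def)
  qed
  ultimately obtain y :: "nat \<Rightarrow> 'a" where bound: "\<And>n. frame_form (y n) (y n) \<le> (2 * C)\<^sup>2"
    and cauchy: "\<And>n m. n \<le> m \<Longrightarrow> frame_form (y n - y m) (y n - y m) \<le> 4 / (real n + 1)"
    and lim: "\<And>z. (\<lambda>n. frame_form (y n) z) \<longlonglongrightarrow> re_ip (K x) z"
    by (rule q.riesz_sequence[OF real_vector.subspace_UNIV _ C]) auto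
  have partial: "(\<Sum>i\<in>F. (norm (coef i z))\<^sup>2) \<le> frame_form z z" if "finite F" "F \<subseteq> I" for F z
    unfolding frame_form_self using that
    by (intro finite_sum_le_infsum summable_norm_coef_if_bessel_bound[OF B]) auto
  have diff_le: "(\<Sum>i\<in>F. (norm (coef i (y n) - coef i (y m)))\<^sup>2) \<le> 4 / (real n + 1)"
    if "finite F" "F \<subseteq> I" "n \<le> m" for F n m
  proof -
    have "(\<Sum>i\<in>F. (norm (coef i (y n) - coef i (y m)))\<^sup>2)
        = (\<Sum>i\<in>F. (norm (coef i (y n - y m)))\<^sup>2)"
      using that(2) by (intro sum.cong) (auto simp: linear_diff[OF linear_coef])
    also have "\<dots> \<le> frame_form (y n - y m) (y n - y m)"
      using that(1,2) by (rule partial)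
    also have "\<dots> \<le> 4 / (real n + 1)" using that(3) by (rule cauchy)
    finally show ?thesis .
  qed
  \<comment> \<open>The sequence y is known to be Cauchy only in the frame form, so limits are taken
    coefficient by coefficient.\<close>
  have "\<exists>a. (\<lambda>n. coef i (y n)) \<longlonglongrightarrow> a" if "i \<in> I" for i
  proof -
    have "Cauchy (\<lambda>n. coef i (y n))"
      by (rule Cauchy_if_norm_diff_sq_le) (use diff_le[of "{i}"] that in simp)
    then show ?thesis by (simp add: Cauchy_convergent_iff convergent_def)
  qed
  then have "\<exists>f. \<forall>i. i \<in> I \<longrightarrow> (\<lambda>n. coef i (y n)) \<longlonglongrightarrow> f i"
    by (intro choice) blast
  then obtain f where f: "\<And>i. i \<in> I \<Longrightarrow> (\<lambda>n. coef i (y n)) \<longlonglongrightarrow> f i" by blast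
  have fW: "f i \<in> W i" if "i \<in> I" for i
    by (rule closed_sequentially[OF closed_subspaces[OF that] coef_in[OF that] f[OF that]])
  have f_le: "(\<Sum>i\<in>F. (norm (f i))\<^sup>2) \<le> (2 * C)\<^sup>2" if F: "finite F" "F \<subseteq> I" for F
  proof (rule LIMSEQ_le_const2)
    show "(\<lambda>n. \<Sum>i\<in>F. (norm (coef i (y n)))\<^sup>2) \<longlonglongrightarrow> (\<Sum>i\<in>F. (norm (f i))\<^sup>2)"
      using F f by (intro tendsto_sum tendsto_power tendsto_norm) auto
    show "\<exists>N. \<forall>n\<ge>N. (\<Sum>i\<in>F. (norm (coef i (y n)))\<^sup>2) \<le> (2 * C)\<^sup>2"
      using partial[OF F] bound by (blast intro: order_trans)
  qed
  \<comment> \<open>Let m tend to infinity in \<open>diff_le\<close> with F fixed; the rate does not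
    depend on F, so this is convergence in the l2 sum.\<close>
  have f_diff: "(\<Sum>i\<in>F. (norm (coef i (y n) - f i))\<^sup>2) \<le> 4 / (real n + 1)"
    if F: "finite F" "F \<subseteq> I" for F n
  proof (rule LIMSEQ_le_const2)
    show "(\<lambda>m. \<Sum>i\<in>F. (norm (coef i (y n) - coef i (y m)))\<^sup>2)
        \<longlonglongrightarrow> (\<Sum>i\<in>F. (norm (coef i (y n) - f i))\<^sup>2)"
      using F f by (intro tendsto_sum tendsto_power tendsto_norm tendsto_diff tendsto_const) auto
    show "\<exists>N. \<forall>m\<ge>N. (\<Sum>i\<in>F. (norm (coef i (y n) - coef i (y m)))\<^sup>2) \<le> 4 / (real n + 1)"
      using diff_le[OF F] by blast
  qed
  have f_summable: "(\<lambda>i. (norm (f i))\<^sup>2) summable_on I"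
    by (intro nonneg_bdd_above_summable_on bdd_aboveI2[where M="(2 * C)\<^sup>2"]) (use f_le in auto)
  then have l2: "f \<in> l2_sum I W" using fW by (simp add: l2_sum_def)
  have "(\<Sum>\<^sub>\<infinity>i\<in>I. (norm (f i))\<^sup>2) \<le> (2 * C)\<^sup>2"
    using f_summable f_le by (rule infsum_le_finite_sums)
  then have "l2_norm ip I f \<le> sqrt ((2 * C)\<^sup>2)"
    unfolding l2_norm_eq[OF l2] by (rule real_sqrt_le_mono)
  then have norm_f: "l2_norm ip I f \<le> (2 / sqrt A) * norm x"
    using C by (simp add: C_def)
  obtain s where s: "((\<lambda>i. v i *\<^sub>R f i) has_sum s) I"
    using weighted_summable_if_bessel_bound[OF B l2] by (auto simp: summable_on_def)
  \<comment> \<open>For each z, \<open>frame_form (y n) z\<close> tends to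
    \<open>re_ip (K x) z\<close> by construction and to \<open>re_ip s z\<close> because the
    coefficients of \<open>y n\<close> approach f in the l2 sum.\<close>
  have "s = K x"
  proof (rule eq_if_re_ip_eq)
    fix z
    let ?Q = "sqrt (frame_form z z)"
    have le: "\<bar>frame_form (y n) z - re_ip s z\<bar> \<le> sqrt (4 / (real n + 1)) * ?Q" for n
    proof -
      \<comment> \<open>Stated for any g with these norms, to serve for the difference and for its
        negative and so give the absolute value.\<close>
      have finite_le: "(\<Sum>i\<in>F. re_ip (g i) (coef i z)) \<le> sqrt (4 / (real n + 1)) * ?Q"
        if F: "finite F" "F \<subseteq> I"
          and g: "\<And>i. norm (g i) = norm (coef i (y n) - f i)" for F g
      proof -
        have "(\<Sum>i\<in>F. re_ip (g i) (coef i z))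
            \<le> L2_set (\<lambda>i. norm (g i)) F * L2_set (\<lambda>i. norm (coef i z)) F"
          by (rule sum_re_ip_le)
        also have "\<dots> \<le> sqrt (4 / (real n + 1)) * ?Q"
          unfolding L2_set_def g
          by (intro mult_mono real_sqrt_le_mono f_diff partial F real_sqrt_ge_zero sum_nonneg) auto
        finally show ?thesis .
      qed
      have "((\<lambda>i. re_ip (coef i (y n)) (coef i z) + - re_ip (f i) (coef i z))
          has_sum (frame_form (y n) z + - re_ip s z)) I"
        by (intro has_sum_add has_sum_uminusI frame_form_has_sum[OF B] re_ip_has_sum s fW)
      then have *: "((\<lambda>i. re_ip (coef i (y n) - f i) (coef i z))
          has_sum (frame_form (y n) z - re_ip s z)) I"
        by (simp add: re.diff_left)
      have "frame_form (y n) z - re_ip s z \<le> sqrt (4 / (real n + 1)) * ?Q"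
        using * by (rule has_sum_le_finite_sums) (intro finite_le refl)
      moreover have "((\<lambda>i. re_ip (f i - coef i (y n)) (coef i z))
          has_sum (- (frame_form (y n) z - re_ip s z))) I"
        using has_sum_uminusI[OF *] by (simp add: re.diff_left)
      then have "- (frame_form (y n) z - re_ip s z) \<le> sqrt (4 / (real n + 1)) * ?Q"
        by (rule has_sum_le_finite_sums) (intro finite_le norm_minus_commute)
      ultimately show ?thesis by linarith
    qed
    have "(\<lambda>n. 4 * (1 / (real n + 1))) \<longlonglongrightarrow> 4 * 0"
      using LIMSEQ_inverse_real_of_nat
      by (intro tendsto_mult tendsto_const) (simp add: inverse_eq_divide add.commute)
    then have "(\<lambda>n. sqrt (4 / (real n + 1)) * ?Q) \<longlonglongrightarrow> sqrt 0 * ?Q"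
      by (intro tendsto_mult tendsto_real_sqrt tendsto_const) simp
    then have "(\<lambda>n. frame_form (y n) z - re_ip s z) \<longlonglongrightarrow> 0"
      unfolding mult_zero_left real_sqrt_zero
      by (rule Lim_null_comparison[OF always_eventually, rotated])
        (simp only: real_norm_def le simp_thms)
    then have "(\<lambda>n. frame_form (y n) z) \<longlonglongrightarrow> re_ip s z" by (rule LIM_zero_cancel)
    then show "re_ip s z = re_ip (K x) z" using lim by (rule LIMSEQ_unique)
  qed
  then show ?thesis using l2 s norm_f by blast
qed

end

theorem theorem3p4:
  fixes smul :: "'k::rc_field \<Rightarrow> 'a::banach \<Rightarrow> 'a"
    and ip :: "'a \<Rightarrow> 'a \<Rightarrow> 'k"
    and K :: "'a \<Rightarrow> 'a"
    and I :: "'i set"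
    and W :: "'i \<Rightarrow> 'a set"
    and v :: "'i \<Rightarrow> real"
  assumes "hilbert_space smul ip"
    and "separable_space (euclidean :: 'a topology)"
    and "bounded_operator smul K"
    and "countable I"
    and "\<And>i. i \<in> I \<Longrightarrow> module.subspace smul (W i) \<and> closed (W i)"
    and "\<And>i. i \<in> I \<Longrightarrow> v i > 0"
  shows "atomic_subspace ip I W v K \<longleftrightarrow>
    (\<exists>A B. A > 0 \<and> B > 0 \<and>
      (\<forall>f. (\<lambda>i. (v i)\<^sup>2 * (norm (orth_proj ip (W i) f))\<^sup>2) summable_on I \<and>
        A * (norm (hilbert_adjoint ip K f))\<^sup>2
          \<le> (\<Sum>\<^sub>\<infinity>i\<in>I. (v i)\<^sup>2 * (norm (orth_proj ip (W i) f))\<^sup>2) \<and>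
        (\<Sum>\<^sub>\<infinity>i\<in>I. (v i)\<^sup>2 * (norm (orth_proj ip (W i) f))\<^sup>2) \<le> B * (norm f)\<^sup>2))"
proof -
  interpret hilbert_space smul ip by fact
  interpret weighted_subspaces smul ip I W v
    by unfold_locales (use assms(5) in auto)
  note K = \<open>bounded_operator smul K\<close>
  show ?thesis
    unfolding norm_coef[symmetric]
  proof
    assume "atomic_subspace ip I W v K"
    then obtain A B where A: "A > 0" and B: "bessel_bound B"
      and lower: "\<And>x. A * (norm (hilbert_adjoint ip K x))\<^sup>2 \<le> (\<Sum>\<^sub>\<infinity>i\<in>I. (norm (coef i x))\<^sup>2)"
      using atomic_imp_bounds[OF K] by blast
    \<comment> \<open>The Bessel constant may be 0; adding 1 to its square makes the upper constant
      positive.\<close>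
    have "(\<Sum>\<^sub>\<infinity>i\<in>I. (norm (coef i f))\<^sup>2) \<le> (B\<^sup>2 + 1) * (norm f)\<^sup>2" for f
      using summable_norm_coef_if_bessel_bound(2)[OF B, of f]
      by (simp add: power_mult_distrib distrib_right add_increasing2)
    moreover have "B\<^sup>2 + 1 > 0" by (simp add: add_nonneg_pos)
    ultimately show "\<exists>A B. A > 0 \<and> B > 0 \<and> (\<forall>f. (\<lambda>i. (norm (coef i f))\<^sup>2) summable_on I \<and>
        A * (norm (hilbert_adjoint ip K f))\<^sup>2 \<le> (\<Sum>\<^sub>\<infinity>i\<in>I. (norm (coef i f))\<^sup>2) \<and>
        (\<Sum>\<^sub>\<infinity>i\<in>I. (norm (coef i f))\<^sup>2) \<le> B * (norm f)\<^sup>2)"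
      using A lower summable_norm_coef_if_bessel_bound(1)[OF B] by blast
  next
    assume "\<exists>A B. A > 0 \<and> B > 0 \<and> (\<forall>f. (\<lambda>i. (norm (coef i f))\<^sup>2) summable_on I \<and>
        A * (norm (hilbert_adjoint ip K f))\<^sup>2 \<le> (\<Sum>\<^sub>\<infinity>i\<in>I. (norm (coef i f))\<^sup>2) \<and>
        (\<Sum>\<^sub>\<infinity>i\<in>I. (norm (coef i f))\<^sup>2) \<le> B * (norm f)\<^sup>2)"
    then obtain A B where A: "A > 0" and B: "B > 0"
      and summable: "\<And>f. (\<lambda>i. (norm (coef i f))\<^sup>2) summable_on I"
      and lower: "\<And>f. A * (norm (hilbert_adjoint ip K f))\<^sup>2 \<le> (\<Sum>\<^sub>\<infinity>i\<in>I. (norm (coef i f))\<^sup>2)"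
      and upper: "\<And>f. (\<Sum>\<^sub>\<infinity>i\<in>I. (norm (coef i f))\<^sup>2) \<le> B * (norm f)\<^sup>2"
      by blast
    \<comment> \<open>\<open>bessel_bound\<close> controls norms rather than their squares, hence
      the square root.\<close>
    have bessel: "bessel_bound (sqrt B)"
      unfolding bessel_bound_def
    proof (intro allI impI)
      fix F x assume F: "finite F \<and> F \<subseteq> I"
      then have "L2_set (\<lambda>i. norm (coef i x)) F \<le> sqrt (\<Sum>\<^sub>\<infinity>i\<in>I. (norm (coef i x))\<^sup>2)"
        by (intro L2_set_le_infsum summable) auto
      also have "\<dots> \<le> sqrt (B * (norm x)\<^sup>2)" by (intro real_sqrt_le_mono upper)
      finally show "L2_set (\<lambda>i. norm (coef i x)) F \<le> sqrt B * norm x"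
        by (simp add: real_sqrt_mult)
    qed
    show "atomic_subspace ip I W v K"
      unfolding atomic_subspace_def
    proof (intro conjI ballI exI[of _ "2 / sqrt A"] allI)
      show "(\<lambda>i. v i *\<^sub>R f i) summable_on I" if "f \<in> l2_sum I W" for f
        using bessel that by (rule weighted_summable_if_bessel_bound)
    qed (use A bounds_imp_representation[OF K bessel A lower] in auto)
  qed
qed

end
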